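(* For every sequent $S$: $\mathbf{LJ}^{++}\vdash S$ if and only if $\mathbf{QFS}\vdash S$.
   Context: Sequents are $\Gamma\Rightarrow\Delta$ with $\Gamma,\Delta$ finite multisets of first-order formulas. $\mathbf{LK}$ is the usual first-order sequent calculus with axioms $p\Rightarrow p$ ($p$ atomic) and $\bot\Rightarrow$, left/right weakening and contraction, rules $(L\wedge_1),(L\wedge_2),(R\wedge),(R\vee_1),(R\vee_2),(L\vee)$, $(L\to)$: from $\Gamma\Rightarrow A,\Delta$ and $\Gamma,B\Rightarrow\Delta$ infer $\Gamma,A\to B\Rightarrow\Delta$, $(R\to)$, quantifier rules $(\forall L)$: $\Gamma,A(t)\Rightarrow\Delta/\Gamma,\forall xA(x)\Rightarrow\Delta$; $(\exists R)$: $\Gamma\Rightarrow A(t),\Delta/\Gamma\Rightarrow\exists xA(x),\Delta$ (terms $t$ without bound variables); $(\forall R)$: $\Gamma\Rightarrow A(y),\Delta/\Gamma\Rightarrow\forall xA(x),\Delta$; $(\exists L)$: $\Gamma,A(y)\Rightarrow\Delta/\Gamma,\exists xA(x)\Rightarrow\Delta$, with the eigenvariable condition that $y$ is not free in the conclusion; and cut. $\mathbf{LJ}$ is the single-conclusion version (succedents contain at most one formula). Rules $(\forall R),(\exists L)$ are strong-quantifier inferences; their variable $a$ replaced by the bound variable is the characteristic variable. In a proof $\pi$, write $a<_\pi b$ if $\pi$ contains a strong-quantifier inference from $\Gamma\Rightarrow A(a,b,\vec c)$ to $\Gamma\Rightarrow\forall xA(x,b,\vec c)$ or from $A(a,b,\vec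 c),\Gamma\Rightarrow\Delta$ to $\exists xA(x,b,\vec c),\Gamma\Rightarrow\Delta$. A quantifier inference is suitable for $\pi$ if it is a weak-quantifier inference, or (1) its characteristic variable does not occur in the end-sequent of $\pi$, (2) $<_\pi$ is acyclic, and (3) any two strong-quantifier inferences of $\pi$ with the same characteristic variable have the same principal formula. $\mathbf{LJ}^{++}$ is $\mathbf{LJ}$ without the eigenvariable condition, with the restriction that a proof contains only quantifier inferences suitable for it. $\mathbf{QFS}\vdash\Pi\Rightarrow\Gamma$ means: there is a finite multiset $\Delta$ of instances of $\mathrm{CD}$: $\forall x(A(x)\vee B)\to\forall xA(x)\vee B$, $\mathrm{ED}$: $(B\to\exists xA(x))\to\exists x(B\to A(x))$, $\mathrm{SW}$: $(\forall xA(x)\to B)\to\exists x(A(x)\to B)$ (with $x$ not free in $B$) such that $\mathbf{LJ}\vdash\Delta,\Pi\Rightarrow\Gamma$.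
   Formalization: In QFS the multiset Δ may contain, besides instances of CD, ED and SW, also universal generalizations of such instances; with ungeneralized open instances only, the direction from LJ++ to QFS fails. *)

theory Defs
  imports "HOL-Library.Multiset"
begin

text \<open>
  Variables are de Bruijn indices: under \<open>k\<close> quantifiers the index \<open>n + k\<close> denotes the free
  variable \<open>n\<close>.  Formulas are thus identified up to renaming of bound variables, substitution is
  capture-free, and \<open>A\<close> in \<open>\<^bold>\<forall> A\<close> plays the role of \<open>A(x)\<close>, with \<open>x\<close> being index \<open>0\<close>.
  A function or predicate symbol is a name together with the number of its arguments.
\<close>

datatype 'f tm = Var nat | Fun 'f "'f tm list"

datatype ('f, 'p) fm =
    Falsum
  | Pred 'p "'f tm list"
  | Conj "('f, 'p) fm" "('f, 'p) fm"  (infixr \<open>\<^bold>\<and>\<close> 75)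
  | Disj "('f, 'p) fm" "('f, 'p) fm"  (infixr \<open>\<^bold>\<or>\<close> 75)
  | Imp "('f, 'p) fm" "('f, 'p) fm"  (infixr \<open>\<^bold>\<rightarrow>\<close> 70)
  | All "('f, 'p) fm"  (\<open>\<^bold>\<forall> _\<close> [80] 80)
  | Ex "('f, 'p) fm"  (\<open>\<^bold>\<exists> _\<close> [80] 80)

fun fv_tm :: "'f tm \<Rightarrow> nat set" where
  "fv_tm (Var n) = {n}"
| "fv_tm (Fun f ts) = (\<Union>t \<in> set ts. fv_tm t)"

primrec fv :: "('f, 'p) fm \<Rightarrow> nat set" where
  "fv Falsum = {}"
| "fv (Pred p ts) = (\<Union>t \<in> set ts. fv_tm t)"
| "fv (A \<^bold>\<and> B) = fv A \<union> fv B"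
| "fv (A \<^bold>\<or> B) = fv A \<union> fv B"
| "fv (A \<^bold>\<rightarrow> B) = fv A \<union> fv B"
| "fv (\<^bold>\<forall> A) = {n. Suc n \<in> fv A}"
| "fv (\<^bold>\<exists> A) = {n. Suc n \<in> fv A}"

fun subst_tm :: "(nat \<Rightarrow> 'f tm) \<Rightarrow> 'f tm \<Rightarrow> 'f tm" where
  "subst_tm \<sigma> (Var n) = \<sigma> n"
| "subst_tm \<sigma> (Fun f ts) = Fun f (map (subst_tm \<sigma>) ts)"

definition up :: "(nat \<Rightarrow> 'f tm) \<Rightarrow> nat \<Rightarrow> 'f tm" where
  "up \<sigma> = case_nat (Var 0) (\<lambda>n. subst_tm (\<lambda>m. Var (Suc m)) (\<sigma> n))"

primrec subst :: "(nat \<Rightarrow> 'f tm) \<Rightarrow> ('f, 'p) fm \<Rightarrow> ('f, 'p) fm" where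
  "subst \<sigma> Falsum = Falsum"
| "subst \<sigma> (Pred p ts) = Pred p (map (subst_tm \<sigma>) ts)"
| "subst \<sigma> (A \<^bold>\<and> B) = subst \<sigma> A \<^bold>\<and> subst \<sigma> B"
| "subst \<sigma> (A \<^bold>\<or> B) = subst \<sigma> A \<^bold>\<or> subst \<sigma> B"
| "subst \<sigma> (A \<^bold>\<rightarrow> B) = subst \<sigma> A \<^bold>\<rightarrow> subst \<sigma> B"
| "subst \<sigma> (\<^bold>\<forall> A) = \<^bold>\<forall> (subst (up \<sigma>) A)"
| "subst \<sigma> (\<^bold>\<exists> A) = \<^bold>\<exists> (subst (up \<sigma>) A)"

text \<open>\<open>inst A t\<close> is \<open>A(t)\<close>; \<open>shift B\<close> is \<open>B\<close> placed under a quantifier that does not bind in it.\<close>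

definition inst :: "('f, 'p) fm \<Rightarrow> 'f tm \<Rightarrow> ('f, 'p) fm" where
  "inst A t = subst (case_nat t Var) A"

definition shift :: "('f, 'p) fm \<Rightarrow> ('f, 'p) fm" where
  "shift B = subst (\<lambda>n. Var (Suc n)) B"

datatype ('f, 'p) sequent =
  Sequent (ante: "('f, 'p) fm multiset") (succe: "('f, 'p) fm multiset")  (infix \<open>\<^bold>\<Rightarrow>\<close> 40)

definition fv_seq :: "('f, 'p) sequent \<Rightarrow> nat set" where
  "fv_seq S = (\<Union>A \<in> set_mset (ante S + succe S). fv A)"

text \<open>Strong-quantifier inferences record their characteristic variable and principal formula.\<close>

datatype ('f, 'p) kind = NonQuant | WeakQuant | StrongQuant nat "('f, 'p) fm"

text \<open>
  Inferences of \<open>\<^bold>L\<^bold>J\<close>, without the eigenvariable condition.  That succedents have at most one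
  formula is built into the axioms and the right rules and inherited by the left rules
  (see \<open>succedent_le_1\<close> below); right contraction is void under this restriction.
\<close>

inductive LJ_inference ::
  "('f, 'p) kind \<Rightarrow> ('f, 'p) sequent list \<Rightarrow> ('f, 'p) sequent \<Rightarrow> bool" where
  Ax: "LJ_inference NonQuant [] ({#Pred p ts#} \<^bold>\<Rightarrow> {#Pred p ts#})"
| FalsumL: "LJ_inference NonQuant [] ({#Falsum#} \<^bold>\<Rightarrow> {#})"
| WeakL: "LJ_inference NonQuant [\<Gamma> \<^bold>\<Rightarrow> \<Delta>] (add_mset A \<Gamma> \<^bold>\<Rightarrow> \<Delta>)"
| WeakR: "LJ_inference NonQuant [\<Gamma> \<^bold>\<Rightarrow> {#}] (\<Gamma> \<^bold>\<Rightarrow> {#A#})"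
| ContrL: "LJ_inference NonQuant [add_mset A (add_mset A \<Gamma>) \<^bold>\<Rightarrow> \<Delta>] (add_mset A \<Gamma> \<^bold>\<Rightarrow> \<Delta>)"
| ConjL1: "LJ_inference NonQuant [add_mset A \<Gamma> \<^bold>\<Rightarrow> \<Delta>] (add_mset (A \<^bold>\<and> B) \<Gamma> \<^bold>\<Rightarrow> \<Delta>)"
| ConjL2: "LJ_inference NonQuant [add_mset B \<Gamma> \<^bold>\<Rightarrow> \<Delta>] (add_mset (A \<^bold>\<and> B) \<Gamma> \<^bold>\<Rightarrow> \<Delta>)"
| ConjR: "LJ_inference NonQuant [\<Gamma> \<^bold>\<Rightarrow> {#A#}, \<Gamma> \<^bold>\<Rightarrow> {#B#}] (\<Gamma> \<^bold>\<Rightarrow> {#A \<^bold>\<and> B#})"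
| DisjR1: "LJ_inference NonQuant [\<Gamma> \<^bold>\<Rightarrow> {#A#}] (\<Gamma> \<^bold>\<Rightarrow> {#A \<^bold>\<or> B#})"
| DisjR2: "LJ_inference NonQuant [\<Gamma> \<^bold>\<Rightarrow> {#B#}] (\<Gamma> \<^bold>\<Rightarrow> {#A \<^bold>\<or> B#})"
| DisjL: "LJ_inference NonQuant [add_mset A \<Gamma> \<^bold>\<Rightarrow> \<Delta>, add_mset B \<Gamma> \<^bold>\<Rightarrow> \<Delta>]
    (add_mset (A \<^bold>\<or> B) \<Gamma> \<^bold>\<Rightarrow> \<Delta>)"
| ImpL: "LJ_inference NonQuant [\<Gamma> \<^bold>\<Rightarrow> {#A#}, add_mset B \<Gamma> \<^bold>\<Rightarrow> \<Delta>]
    (add_mset (A \<^bold>\<rightarrow> B) \<Gamma> \<^bold>\<Rightarrow> \<Delta>)"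
| ImpR: "LJ_inference NonQuant [add_mset A \<Gamma> \<^bold>\<Rightarrow> {#B#}] (\<Gamma> \<^bold>\<Rightarrow> {#A \<^bold>\<rightarrow> B#})"
| AllL: "LJ_inference WeakQuant [add_mset (inst A t) \<Gamma> \<^bold>\<Rightarrow> \<Delta>] (add_mset (\<^bold>\<forall> A) \<Gamma> \<^bold>\<Rightarrow> \<Delta>)"
| ExR: "LJ_inference WeakQuant [\<Gamma> \<^bold>\<Rightarrow> {#inst A t#}] (\<Gamma> \<^bold>\<Rightarrow> {#\<^bold>\<exists> A#})"
| AllR: "LJ_inference (StrongQuant y (\<^bold>\<forall> A)) [\<Gamma> \<^bold>\<Rightarrow> {#inst A (Var y)#}] (\<Gamma> \<^bold>\<Rightarrow> {#\<^bold>\<forall> A#})"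
| ExL: "LJ_inference (StrongQuant y (\<^bold>\<exists> A)) [add_mset (inst A (Var y)) \<Gamma> \<^bold>\<Rightarrow> \<Delta>]
    (add_mset (\<^bold>\<exists> A) \<Gamma> \<^bold>\<Rightarrow> \<Delta>)"
| Cut: "LJ_inference NonQuant [\<Gamma> \<^bold>\<Rightarrow> {#A#}, add_mset A \<Pi> \<^bold>\<Rightarrow> \<Delta>] (\<Gamma> + \<Pi> \<^bold>\<Rightarrow> \<Delta>)"

datatype ('f, 'p) prooftree =
  Infer (last_kind: "('f, 'p) kind") (end_seq: "('f, 'p) sequent") "('f, 'p) prooftree list"

inductive preproof :: "('f, 'p) prooftree \<Rightarrow> bool" where
  "LJ_inference k (map end_seq \<pi>s) S \<Longrightarrow> (\<And>\<pi>. \<pi> \<in> set \<pi>s \<Longrightarrow> preproof \<pi>) \<Longrightarrow>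
    preproof (Infer k S \<pi>s)"

text \<open>Each inference of a proof is represented by its kind and its conclusion.\<close>

fun inferences :: "('f, 'p) prooftree \<Rightarrow> (('f, 'p) kind \<times> ('f, 'p) sequent) set" where
  "inferences (Infer k S \<pi>s) = insert (k, S) (\<Union>\<pi> \<in> set \<pi>s. inferences \<pi>)"

lemma succedent_le_1: "preproof \<pi> \<Longrightarrow> size (succe (end_seq \<pi>)) \<le> 1"
proof (induction rule: preproof.induct)
  case (1 k \<pi>s S)
  have "\<forall>T \<in> set (map end_seq \<pi>s). size (succe T) \<le> 1"
    using 1(3) by auto
  with 1(1) show ?case
    by (cases rule: LJ_inference.cases) auto
qed

definition LJ_proof :: "('f, 'p) prooftree \<Rightarrow> bool" where
  "LJ_proof \<pi> \<longleftrightarrow> preproof \<pi> \<and>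
    (\<forall>y F S. (StrongQuant y F, S) \<in> inferences \<pi> \<longrightarrow> y \<notin> fv_seq S)"

definition LJ :: "('f, 'p) sequent \<Rightarrow> bool" where
  "LJ S \<longleftrightarrow> (\<exists>\<pi>. LJ_proof \<pi> \<and> end_seq \<pi> = S)"

text \<open>
  \<open>(a, b) \<in> char_less \<pi>\<close> is \<open>a <\<^sub>\<pi> b\<close>.  Without the eigenvariable condition \<open>a\<close> may itself be free
  in the principal formula, which gives the cycle \<open>a <\<^sub>\<pi> a\<close>.
\<close>

definition char_less :: "('f, 'p) prooftree \<Rightarrow> (nat \<times> nat) set" where
  "char_less \<pi> = {(a, b). \<exists>F S. (StrongQuant a F, S) \<in> inferences \<pi> \<and> b \<in> fv F}"

fun suitable :: "('f, 'p) prooftree \<Rightarrow> ('f, 'p) kind \<Rightarrow> bool" where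
  "suitable \<pi> (StrongQuant a F) \<longleftrightarrow>
     a \<notin> fv_seq (end_seq \<pi>) \<and>
     acyclic (char_less \<pi>) \<and>
     (\<forall>b G H S T. (StrongQuant b G, S) \<in> inferences \<pi> \<longrightarrow>
        (StrongQuant b H, T) \<in> inferences \<pi> \<longrightarrow> G = H)"
| "suitable \<pi> WeakQuant \<longleftrightarrow> True"
| "suitable \<pi> NonQuant \<longleftrightarrow> True"

definition LJpp_proof :: "('f, 'p) prooftree \<Rightarrow> bool" where
  "LJpp_proof \<pi> \<longleftrightarrow> preproof \<pi> \<and> (\<forall>(k, S) \<in> inferences \<pi>. suitable \<pi> k)"

definition LJpp :: "('f, 'p) sequent \<Rightarrow> bool" where
  "LJpp S \<longleftrightarrow> (\<exists>\<pi>. LJpp_proof \<pi> \<and> end_seq \<pi> = S)"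

text \<open>
  Instances of the quantifier-shift schemata.  As usual for axiom schemata, the parameters of an
  instance are generic: they may be universally quantified (rule \<open>Gen\<close>).  This matters because an
  instance is used here as a hypothesis in the antecedent, where \<open>(\<forall>R)\<close> and \<open>(\<exists>L)\<close> cannot act on
  its free variables: a hypothesis with a free parameter says nothing about its other values.
\<close>

inductive QFS_instance :: "('f, 'p) fm \<Rightarrow> bool" where
  CD: "QFS_instance (\<^bold>\<forall> (A \<^bold>\<or> shift B) \<^bold>\<rightarrow> (\<^bold>\<forall> A) \<^bold>\<or> B)"
| ED: "QFS_instance ((B \<^bold>\<rightarrow> \<^bold>\<exists> A) \<^bold>\<rightarrow> \<^bold>\<exists> (shift B \<^bold>\<rightarrow> A))"
| SW: "QFS_instance (((\<^bold>\<forall> A) \<^bold>\<rightarrow> B) \<^bold>\<rightarrow> \<^bold>\<exists> (A \<^bold>\<rightarrow> shift B))"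
| Gen: "QFS_instance F \<Longrightarrow> QFS_instance (\<^bold>\<forall> F)"

definition QFS :: "('f, 'p) sequent \<Rightarrow> bool" where
  "QFS S \<longleftrightarrow> (\<exists>\<Delta>. (\<forall>F \<in># \<Delta>. QFS_instance F) \<and> LJ (\<Delta> + ante S \<^bold>\<Rightarrow> succe S))"

end

theory Submission
  imports Defs
begin

text \<open>
  Given an \<open>LJ\<^sup>+\<^sup>+\<close> proof, add to the antecedents the implication \<open>A(a) \<rightarrow> \<forall>x A(x)\<close>, respectively
  \<open>\<exists>x A(x) \<rightarrow> A(a)\<close>, for each of its strong-quantifier inferences: these then become propositional
  and the proof is one in \<open>LJ\<close>.  The implications are removed in the order \<open><\<^sub>\<pi>\<close>, by \<open>(\<exists>L)\<close> on the
  characteristic variable and a cut with \<open>\<exists>x (A(x) \<rightarrow> \<forall>x A(x))\<close> or \<open>\<exists>x (\<exists>x A(x) \<rightarrow> A(x))\<close>, which follow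
  from instances of SW and ED.  The instances have to be universally closed, so that their
  parameters do not violate later eigenvariable conditions.

  Conversely, CD, ED and SW are derivable in \<open>LJ\<^sup>+\<^sup>+\<close> by strong-quantifier inferences whose
  characteristic variable is still free in the context, and an \<open>LJ\<close> proof becomes an \<open>LJ\<^sup>+\<^sup>+\<close> proof once
  its eigenvariables are renamed apart; cuts remove the instances.
\<close>

subsection \<open>Substitution\<close>

lemma subst_tm_comp: "subst_tm \<sigma> (subst_tm \<tau> t) = subst_tm (\<lambda>n. subst_tm \<sigma> (\<tau> n)) t"
  by (induction t) auto

lemma subst_tm_Var: "subst_tm Var t = t"
  by (induction t) (auto simp: map_idI)

lemma subst_tm_cong: "(\<And>n. n \<in> fv_tm t \<Longrightarrow> \<sigma> n = \<tau> n) \<Longrightarrow> subst_tm \<sigma> t = subst_tm \<tau> t"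
  by (induction t) auto

lemma fv_subst_tm: "fv_tm (subst_tm \<sigma> t) = (\<Union>n \<in> fv_tm t. fv_tm (\<sigma> n))"
  by (induction t) auto

lemma finite_fv_tm: "finite (fv_tm t)"
  by (induction t) auto

lemma up_simps [simp]:
  "up \<sigma> 0 = Var 0"
  "up \<sigma> (Suc n) = subst_tm (\<lambda>m. Var (Suc m)) (\<sigma> n)"
  by (simp_all add: up_def)

lemma up_Var: "up Var = Var"
  by (rule ext) (simp add: up_def split: nat.split)

lemma up_comp: "(\<lambda>n. subst_tm (up \<sigma>) (up \<tau> n)) = up (\<lambda>n. subst_tm \<sigma> (\<tau> n))"
proof
  fix n show "subst_tm (up \<sigma>) (up \<tau> n) = up (\<lambda>n. subst_tm \<sigma> (\<tau> n)) n"
    by (cases n) (simp_all add: subst_tm_comp)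
qed

lemma subst_comp: "subst \<sigma> (subst \<tau> A) = subst (\<lambda>n. subst_tm \<sigma> (\<tau> n)) A"
  by (induction A arbitrary: \<sigma> \<tau>) (auto simp: subst_tm_comp up_comp)

lemma subst_Var [simp]: "subst Var A = A"
  by (induction A) (auto simp: subst_tm_Var up_Var map_idI)

lemma subst_cong: "(\<And>n. n \<in> fv A \<Longrightarrow> \<sigma> n = \<tau> n) \<Longrightarrow> subst \<sigma> A = subst \<tau> A"
proof (induction A arbitrary: \<sigma> \<tau>)
  case (Pred p ts)
  then show ?case by (auto intro!: subst_tm_cong)
next
  case (Conj A B)
  have "subst \<sigma> A = subst \<tau> A" "subst \<sigma> B = subst \<tau> B"
    using Conj.prems by (auto intro!: Conj.IH)
  then show ?case by simp
next
  case (Disj A B)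
  have "subst \<sigma> A = subst \<tau> A" "subst \<sigma> B = subst \<tau> B"
    using Disj.prems by (auto intro!: Disj.IH)
  then show ?case by simp
next
  case (Imp A B)
  have "subst \<sigma> A = subst \<tau> A" "subst \<sigma> B = subst \<tau> B"
    using Imp.prems by (auto intro!: Imp.IH)
  then show ?case by simp
next
  case (All A)
  have "up \<sigma> n = up \<tau> n" if "n \<in> fv A" for n
    using that All.prems by (cases n) auto
  from All.IH[OF this] show ?case by simp
next
  case (Ex A)
  have "up \<sigma> n = up \<tau> n" if "n \<in> fv A" for n
    using that Ex.prems by (cases n) auto
  from Ex.IH[OF this] show ?case by simp
qed auto

text \<open>Index 0 contributes nothing, since \<open>up \<sigma>\<close> fixes it; index
  \<open>Suc m\<close> contributes the variables of \<open>\<sigma> m\<close> raised by one. This is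
  the quantifier case of \<open>fv_subst\<close>.\<close>

lemma fv_up: "{n. Suc n \<in> (\<Union>m \<in> X. fv_tm (up \<sigma> m))} = (\<Union>m \<in> {m. Suc m \<in> X}. fv_tm (\<sigma> m))"
proof (intro equalityI subsetI)
  fix n assume "n \<in> {n. Suc n \<in> (\<Union>m \<in> X. fv_tm (up \<sigma> m))}"
  then obtain m where m: "m \<in> X" "Suc n \<in> fv_tm (up \<sigma> m)" by auto
  then show "n \<in> (\<Union>m \<in> {m. Suc m \<in> X}. fv_tm (\<sigma> m))"
    by (cases m) (auto simp: fv_subst_tm)
next
  fix n assume "n \<in> (\<Union>m \<in> {m. Suc m \<in> X}. fv_tm (\<sigma> m))"
  then obtain m where "Suc m \<in> X" "n \<in> fv_tm (\<sigma> m)" by auto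
  then show "n \<in> {n. Suc n \<in> (\<Union>m \<in> X. fv_tm (up \<sigma> m))}"
    by (auto simp: fv_subst_tm intro!: bexI[of _ "Suc m"])
qed

lemma fv_subst: "fv (subst \<sigma> A) = (\<Union>n \<in> fv A. fv_tm (\<sigma> n))"
proof (induction A arbitrary: \<sigma>)
  case (All A)
  then show ?case using fv_up[where X = "fv A" and \<sigma> = \<sigma>] by simp
next
  case (Ex A)
  then show ?case using fv_up[where X = "fv A" and \<sigma> = \<sigma>] by simp
qed (auto simp: fv_subst_tm)

lemma finite_fv [simp]: "finite (fv A)"
proof (induction A)
  case (All A)
  then show ?case using finite_vimageI[of "fv A" Suc] by (simp add: vimage_def)
next
  case (Ex A)
  then show ?case using finite_vimageI[of "fv A" Suc] by (simp add: vimage_def)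
qed (auto simp: finite_fv_tm)

lemma fv_shift: "fv (shift A) = Suc ` fv A"
  by (auto simp: shift_def fv_subst)

lemma fv_inst: "fv (inst A t) \<subseteq> fv (\<^bold>\<forall> A) \<union> fv_tm t"
  by (auto simp: inst_def fv_subst split: nat.splits)

lemma inst_shift [simp]: "inst (shift A) t = A"
  by (simp add: inst_def shift_def subst_comp)

lemma inst_Imp [simp]: "inst (A \<^bold>\<rightarrow> B) t = inst A t \<^bold>\<rightarrow> inst B t"
  by (simp add: inst_def)

lemma inst_Disj [simp]: "inst (A \<^bold>\<or> B) t = inst A t \<^bold>\<or> inst B t"
  by (simp add: inst_def)

lemma subst_up_shift: "subst (up \<sigma>) (shift A) = shift (subst \<sigma> A)"
  by (simp add: shift_def subst_comp)

text \<open>An instance of a substituted body is a single substitution in the body, so inductions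
  generalised over substitutions apply to it directly.\<close>

lemma inst_subst_up: "inst (subst (up \<sigma>) A) t = subst (case_nat t \<sigma>) A"
  unfolding inst_def subst_comp
  by (rule subst_cong) (auto simp: up_def subst_tm_comp subst_tm_Var split: nat.split)

lemma subst_inst: "subst \<sigma> (inst A t) = inst (subst (up \<sigma>) A) (subst_tm \<sigma> t)"
  unfolding inst_subst_up unfolding inst_def subst_comp
  by (rule subst_cong) (auto split: nat.split)

text \<open>Used to rename an eigenvariable: changing \<open>\<sigma>\<close> at \<open>y\<close>
  moves the instance and leaves the quantified formula alone.\<close>

lemma subst_inst_fresh:
  assumes "y \<notin> fv (\<^bold>\<forall> A)"
  shows "subst (\<sigma>(y := t)) (inst A (Var y)) = inst (subst (up \<sigma>) A) t"
  unfolding inst_subst_up unfolding inst_def subst_comp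
  using assms by (intro subst_cong) (auto split: nat.split)

lemma image_subst_fresh:
  assumes "\<forall>A \<in># \<Gamma>. y \<notin> fv A"
  shows "image_mset (subst (\<sigma>(y := t))) \<Gamma> = image_mset (subst \<sigma>) \<Gamma>"
  using assms by (intro image_mset_cong subst_cong) auto

lemma ex_fresh: "finite X \<Longrightarrow> \<exists>y::nat. m \<le> y \<and> (\<forall>b \<in> X. b < y)"
  \<comment> \<open>\<open>insert 0\<close> keeps \<open>Max\<close> meaningful when
    \<open>X\<close> is empty.\<close>
  by (intro exI[of _ "Suc (m + Max (insert 0 X))"])
    (auto simp: less_Suc_eq_le intro!: trans_le_add2)

lemma finite_fv_seq [simp]: "finite (fv_seq S)"
  by (simp add: fv_seq_def)


subsection \<open>Derivability with a side condition on strong-quantifier inferences\<close>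

text \<open>\<open>Q\<close> is checked locally at each strong-quantifier inference. It is used both
  for the eigenvariable condition and for membership in a set fixed in advance, so that the global
  conditions on a proof become accessible to rule induction.\<close>

inductive derivable ::
  "(nat \<Rightarrow> ('f, 'p) fm \<Rightarrow> ('f, 'p) sequent \<Rightarrow> bool) \<Rightarrow> ('f, 'p) sequent \<Rightarrow> bool" for Q where
  infer: "LJ_inference k Ss S \<Longrightarrow> (\<And>T. T \<in> set Ss \<Longrightarrow> derivable Q T) \<Longrightarrow>
    (\<And>y F. k = StrongQuant y F \<Longrightarrow> Q y F S) \<Longrightarrow> derivable Q S"

lemma derivable_iff:
  "derivable Q S \<longleftrightarrow> (\<exists>\<pi>. preproof \<pi> \<and> end_seq \<pi> = S \<and>
     (\<forall>y F T. (StrongQuant y F, T) \<in> inferences \<pi> \<longrightarrow> Q y F T))"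
    (is "_ \<longleftrightarrow> (\<exists>\<pi>. ?ok \<pi> S)")
proof
  assume "derivable Q S"
  then show "\<exists>\<pi>. ?ok \<pi> S"
  proof induction
    case (infer k Ss S)
    then obtain p where p: "\<And>T. T \<in> set Ss \<Longrightarrow> ?ok (p T) T" by metis
    have "map end_seq (map p Ss) = Ss" using p by (simp add: map_idI)
    then have "?ok (Infer k S (map p Ss)) S"
      using infer.hyps(1,3) p by (auto intro!: preproof.intros)
    then show ?case by blast
  qed
next
  assume "\<exists>\<pi>. ?ok \<pi> S"
  then obtain \<pi> where "preproof \<pi>" "end_seq \<pi> = S"
    "\<forall>y F T. (StrongQuant y F, T) \<in> inferences \<pi> \<longrightarrow> Q y F T" by blast
  then show "derivable Q S"
  proof (induction arbitrary: S)
    case (1 k \<pi>s S')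
    have "derivable Q (end_seq \<pi>)" if "\<pi> \<in> set \<pi>s" for \<pi>
      by (rule "1.IH"[OF that refl]) (use that "1.prems"(2) in auto)
    then have "derivable Q T" if "T \<in> set (map end_seq \<pi>s)" for T
      using that by auto
    moreover have "Q y F S'" if "k = StrongQuant y F" for y F
      using that "1.prems"(2) by simp
    ultimately show ?case using derivable.infer[OF "1.hyps"(1)] "1.prems"(1) by simp
  qed
qed

lemma derivable_mono:
  assumes "derivable Q S" "\<And>y F T. Q y F T \<Longrightarrow> R y F T"
  shows "derivable R S"
  using assms by induction (blast intro: derivable.infer)

lemma derivable_rule:
  assumes "LJ_inference k Ss S" "\<forall>T \<in> set Ss. derivable Q T" "\<forall>y F. k = StrongQuant y F \<longrightarrow> Q y F S"
  shows "derivable Q S"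
  using assms by (blast intro: derivable.infer)

lemmas dWeakL = derivable_rule[OF LJ_inference.WeakL, simplified]
lemmas dWeakR = derivable_rule[OF LJ_inference.WeakR, simplified]
lemmas dContrL = derivable_rule[OF LJ_inference.ContrL, simplified]
lemmas dImpL = derivable_rule[OF LJ_inference.ImpL, simplified, OF conjI]
lemmas dImpR = derivable_rule[OF LJ_inference.ImpR, simplified]
lemmas dDisjL = derivable_rule[OF LJ_inference.DisjL, simplified, OF conjI]
lemmas dDisjR1 = derivable_rule[OF LJ_inference.DisjR1, simplified]
lemmas dDisjR2 = derivable_rule[OF LJ_inference.DisjR2, simplified]
lemmas dConjL1 = derivable_rule[OF LJ_inference.ConjL1, simplified]
lemmas dConjL2 = derivable_rule[OF LJ_inference.ConjL2, simplified]
lemmas dConjR = derivable_rule[OF LJ_inference.ConjR, simplified, OF conjI]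
lemmas dAllL = derivable_rule[OF LJ_inference.AllL, simplified]
lemmas dExR = derivable_rule[OF LJ_inference.ExR, simplified]
lemmas dAllR = derivable_rule[OF LJ_inference.AllR, simplified]
lemmas dExL = derivable_rule[OF LJ_inference.ExL, simplified]
lemmas dCut = derivable_rule[OF LJ_inference.Cut, simplified, OF conjI]

lemma derivable_weaken: "derivable Q (\<Gamma> \<^bold>\<Rightarrow> C) \<Longrightarrow> derivable Q (\<Theta> + \<Gamma> \<^bold>\<Rightarrow> C)"
  by (induction \<Theta>) (auto intro: dWeakL)

text \<open>Cut adds up the contexts of its premises, so a context \<open>\<Theta>\<close> carried
  through a whole derivation is doubled there and has to be contracted.\<close>

lemma derivable_contract: "derivable Q (\<Theta> + \<Theta> + \<Gamma> \<^bold>\<Rightarrow> C) \<Longrightarrow> derivable Q (\<Theta> + \<Gamma> \<^bold>\<Rightarrow> C)"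
proof (induction \<Theta> arbitrary: \<Gamma>)
  case (add A \<Theta>)
  have "derivable Q (add_mset A (add_mset A (\<Theta> + \<Theta> + \<Gamma>)) \<^bold>\<Rightarrow> C)"
    using add.prems by (simp add: ac_simps)
  then have "derivable Q (\<Theta> + \<Theta> + add_mset A \<Gamma> \<^bold>\<Rightarrow> C)"
    using dContrL by simp
  from add.IH[OF this] show ?case by simp
qed simp

abbreviation eigen :: "nat \<Rightarrow> ('f, 'p) fm \<Rightarrow> ('f, 'p) sequent \<Rightarrow> bool" where
  "eigen y F S \<equiv> y \<notin> fv_seq S"

lemma LJ_iff_derivable: "LJ S \<longleftrightarrow> derivable eigen S"
  unfolding LJ_def LJ_proof_def derivable_iff by blast

lemma derivable_identity: "derivable eigen ({#A#} \<^bold>\<Rightarrow> {#A#})"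
proof -
  \<comment> \<open>Axioms are atomic, hence the induction on \<open>A\<close>. In the quantifier
    cases the formula needed is an instance of the body, which is a substitution instance and not a
    subformula; hence the arbitrary \<open>\<sigma>\<close>.\<close>
  have "derivable eigen ({#subst \<sigma> A#} \<^bold>\<Rightarrow> {#subst \<sigma> A#})" for \<sigma>
  proof (induction A arbitrary: \<sigma>)
    case Falsum
    show ?case
      using dWeakR[OF derivable_rule[OF LJ_inference.FalsumL]] by simp
  next
    case (Pred p ts)
    show ?case using derivable_rule[OF LJ_inference.Ax] by simp
  next
    case (Conj A B)
    then show ?case by (auto intro!: dConjR intro: dConjL1 dConjL2)
  next
    case (Disj A B)
    then show ?case by (auto intro!: dDisjL intro: dDisjR1 dDisjR2)
  next
    case (Imp A B)
    have "derivable eigen (add_mset (subst \<sigma> A \<^bold>\<rightarrow> subst \<sigma> B) {#subst \<sigma> A#} \<^bold>\<Rightarrow> {#subst \<sigma> B#})"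
      using Imp by (intro dImpL) (auto simp: add_mset_commute intro: dWeakL)
    then show ?case by (auto intro!: dImpR simp: add_mset_commute)
  next
    case (All A)
    obtain y where "\<forall>b \<in> fv_seq ({#subst \<sigma> (\<^bold>\<forall> A)#} \<^bold>\<Rightarrow> {#subst \<sigma> (\<^bold>\<forall> A)#}). b < y"
      using ex_fresh finite_fv_seq by meson
    then have y: "y \<notin> fv_seq ({#subst \<sigma> (\<^bold>\<forall> A)#} \<^bold>\<Rightarrow> {#subst \<sigma> (\<^bold>\<forall> A)#})"
      by blast
    have "derivable eigen ({#subst \<sigma> (\<^bold>\<forall> A)#} \<^bold>\<Rightarrow> {#inst (subst (up \<sigma>) A) (Var y)#})"
      unfolding subst.simps by (rule dAllL[where t = "Var y"]) (simp add: inst_subst_up All)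
    then show ?case using y by (simp add: dAllR)
  next
    case (Ex A)
    obtain y where "\<forall>b \<in> fv_seq ({#subst \<sigma> (\<^bold>\<exists> A)#} \<^bold>\<Rightarrow> {#subst \<sigma> (\<^bold>\<exists> A)#}). b < y"
      using ex_fresh finite_fv_seq by meson
    then have y: "y \<notin> fv_seq ({#subst \<sigma> (\<^bold>\<exists> A)#} \<^bold>\<Rightarrow> {#subst \<sigma> (\<^bold>\<exists> A)#})"
      by blast
    have "derivable eigen ({#inst (subst (up \<sigma>) A) (Var y)#} \<^bold>\<Rightarrow> {#subst \<sigma> (\<^bold>\<exists> A)#})"
      unfolding subst.simps by (rule dExR[where t = "Var y"]) (simp add: inst_subst_up Ex)
    then show ?case using y by (simp add: dExL)
  qed
  from this[of Var] show ?thesis by simp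
qed


subsection \<open>From \<open>LJ\<close> with quantifier shifts to \<open>LJ\<^sup>+\<^sup>+\<close>\<close>

abbreviation strong_in ::
  "(nat \<times> ('f, 'p) fm) set \<Rightarrow> nat \<Rightarrow> ('f, 'p) fm \<Rightarrow> ('f, 'p) sequent \<Rightarrow> bool" where
  "strong_in E y F S \<equiv> (y, F) \<in> E"

text \<open>
  Characteristic variables are chosen numerically larger than the free variables of their
  principal formulas, so that \<open><\<^sub>\<pi>\<close> is contained in \<open>>\<close> and hence acyclic.
\<close>

definition layered :: "nat \<Rightarrow> (nat \<times> ('f, 'p) fm) set \<Rightarrow> bool" where
  "layered m E \<longleftrightarrow> finite E \<and> single_valued E \<and>
     (\<forall>(a, F) \<in> E. m \<le> a \<and> (\<forall>b \<in> fv F. b < a))"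

text \<open>As \<open>m\<close> is arbitrary, several premises can get characteristic variables from
  disjoint ranges, and a final choice of \<open>m\<close> keeps them all above the free variables of
  the end-sequent.\<close>

definition layered_derivable :: "('f, 'p) sequent \<Rightarrow> bool" where
  "layered_derivable S \<longleftrightarrow> (\<forall>m. \<exists>E. layered m E \<and> derivable (strong_in E) S)"

section \<open>Combining layered sets of characteristic variables\<close>

lemma layered_insert:
  assumes "layered (Suc a) E" "m \<le> a" "\<forall>b \<in> fv F. b < a"
  shows "layered m (insert (a, F) E)"
  using assms unfolding layered_def single_valued_def by fastforce

text \<open>The variables of \<open>E\<close> lie below \<open>n\<close> and those of
  \<open>E'\<close> at or above it, so no variable receives two formulas.\<close>

lemma layered_union:
  assumes "layered m E" "layered n E'" "\<forall>a \<in> Domain E. a < n" "m \<le> n"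
  shows "layered m (E \<union> E')"
proof -
  have ge: "n \<le> a" if "(a, F) \<in> E'" for a F
    using that assms(2) by (auto simp: layered_def)
  have lt: "a < n" if "(a, F) \<in> E" for a F
    using that assms(3) by blast
  have "single_valued (E \<union> E')"
    using assms(1,2) unfolding layered_def single_valued_def by (metis UnE ge lt not_less)
  moreover have "m \<le> a \<and> (\<forall>b \<in> fv F. b < a)" if "(a, F) \<in> E \<union> E'" for a F
    using that assms(1,2,4) by (auto simp: layered_def)
  ultimately show ?thesis using assms(1,2) by (auto simp: layered_def)
qed

lemma layered_derivable_list:
  assumes "\<forall>T \<in> set Ss. layered_derivable T"
  shows "\<exists>E. layered m E \<and> (\<forall>T \<in> set Ss. derivable (strong_in E) T)"
  using assms
proof (induction Ss)
  case Nil
  show ?case by (auto simp: layered_def intro!: exI[of _ "{}"])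
next
  case (Cons S Ss)
  then obtain E where E: "layered m E" "\<forall>T \<in> set Ss. derivable (strong_in E) T" by auto
  then have "finite (Domain E)" by (simp add: layered_def finite_Domain)
  then obtain n where n: "m \<le> n" "\<forall>a \<in> Domain E. a < n" using ex_fresh by meson
  have "layered_derivable S" using Cons.prems by simp
  then obtain E' where E': "layered n E'" "derivable (strong_in E') S"
    unfolding layered_derivable_def by meson
  have "layered m (E \<union> E')" using layered_union E(1) E'(1) n by blast
  moreover have "\<forall>T \<in> set (S # Ss). derivable (strong_in (E \<union> E')) T"
    using E(2) E'(2) by (auto elim: derivable_mono)
  ultimately show ?case by blast
qed

text \<open>\<open>y\<close> is picked first; the premises, which may mention it, are then derived
  with characteristic variables from \<open>Suc y\<close> on, so that \<open>(y, F)\<close> cannot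
  collide with theirs.\<close>

lemma layered_derivable_strong:
  assumes "\<And>y. \<forall>T \<in> set (Ss y). layered_derivable T"
  shows "\<exists>y E. layered m E \<and> (y, F) \<in> E \<and> (\<forall>T \<in> set (Ss y). derivable (strong_in E) T)"
proof -
  obtain y where y: "m \<le> y" "\<forall>b \<in> fv F. b < y" using ex_fresh finite_fv by meson
  obtain E where E: "layered (Suc y) E" "\<forall>T \<in> set (Ss y). derivable (strong_in E) T"
    using layered_derivable_list assms by blast
  have "layered m (insert (y, F) E)" using layered_insert E(1) y by blast
  moreover have "\<forall>T \<in> set (Ss y). derivable (strong_in (insert (y, F) E)) T"
    using E(2) by (auto elim: derivable_mono)
  ultimately show ?thesis by blast
qed

lemma layered_derivable_rule:
  assumes "LJ_inference k Ss S" "\<forall>y F. k \<noteq> StrongQuant y F" "\<forall>T \<in> set Ss. layered_derivable T"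
  shows "layered_derivable S"
  unfolding layered_derivable_def
proof
  fix m
  obtain E where "layered m E" "\<forall>T \<in> set Ss. derivable (strong_in E) T"
    using layered_derivable_list[OF assms(3)] by blast
  moreover from this(2) have "derivable (strong_in E) S"
    using derivable_rule[OF assms(1)] assms(2) by blast
  ultimately show "\<exists>E. layered m E \<and> derivable (strong_in E) S" by blast
qed

lemma layered_derivable_strong_rule:
  assumes "\<And>y. LJ_inference (StrongQuant y F) [T y] S" "\<And>y. layered_derivable (T y)"
  shows "layered_derivable S"
  unfolding layered_derivable_def
proof
  fix m
  have "\<exists>y E. layered m E \<and> (y, F) \<in> E \<and> (\<forall>T \<in> set [T y]. derivable (strong_in E) T)"
    by (rule layered_derivable_strong) (simp add: assms(2))
  then show "\<exists>E. layered m E \<and> derivable (strong_in E) S"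
    using derivable_rule[OF assms(1)] by blast
qed

section \<open>Renaming eigenvariables apart\<close>

definition subst_seq :: "(nat \<Rightarrow> 'f tm) \<Rightarrow> ('f, 'p) sequent \<Rightarrow> ('f, 'p) sequent" where
  "subst_seq \<sigma> S = (image_mset (subst \<sigma>) (ante S) \<^bold>\<Rightarrow> image_mset (subst \<sigma>) (succe S))"

lemma LJ_inference_subst:
  assumes "LJ_inference k Ss S" "\<forall>y F. k \<noteq> StrongQuant y F"
  shows "LJ_inference k (map (subst_seq \<sigma>) Ss) (subst_seq \<sigma> S)"
  using assms
  by (cases rule: LJ_inference.cases)
    (simp_all add: subst_seq_def subst_inst LJ_inference.intros)

lemma layered_derivable_subst:
  assumes "derivable eigen S"
  shows "layered_derivable (subst_seq \<sigma> S)"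
  using assms
proof (induction arbitrary: \<sigma>)
  case (infer k Ss S)
  show ?case
  proof (cases "\<exists>y F. k = StrongQuant y F")
    case False
    then have "LJ_inference k (map (subst_seq \<sigma>) Ss) (subst_seq \<sigma> S)"
      using LJ_inference_subst infer.hyps(1) by blast
    moreover have "\<forall>T \<in> set (map (subst_seq \<sigma>) Ss). layered_derivable T"
      using infer.IH by simp
    ultimately show ?thesis using layered_derivable_rule False by blast
  next
    case True
    then obtain y F where k: "k = StrongQuant y F" by blast
    have fresh: "y \<notin> fv_seq S" using infer.hyps(3) k .
    have IH: "layered_derivable (subst_seq \<sigma> T)" if "T \<in> set Ss" for T \<sigma>
      using infer.IH that .
    from infer.hyps(1) show ?thesis unfolding k
    proof (cases rule: LJ_inference.cases)
      case (AllR A \<Gamma>)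
      let ?T = "\<lambda>z. image_mset (subst \<sigma>) \<Gamma> \<^bold>\<Rightarrow> {#inst (subst (up \<sigma>) A) (Var z)#}"
      \<comment> \<open>As \<open>y\<close> is not free in the conclusion, changing
        \<open>\<sigma>\<close> at \<open>y\<close> affects only the instance. The induction
        hypothesis thus gives the premise for every \<open>z\<close>, and the layering may choose
        \<open>z\<close>.\<close>
      have "?T z = subst_seq (\<sigma>(y := Var z)) (\<Gamma> \<^bold>\<Rightarrow> {#inst A (Var y)#})" for z
        using fresh AllR
        by (simp add: subst_seq_def fv_seq_def subst_inst_fresh image_subst_fresh)
      then have "layered_derivable (?T z)" for z using IH AllR by simp
      moreover have "LJ_inference (StrongQuant z (\<^bold>\<forall> (subst (up \<sigma>) A))) [?T z] (subst_seq \<sigma> S)" for z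
        using AllR LJ_inference.AllR by (simp add: subst_seq_def)
      ultimately show ?thesis using layered_derivable_strong_rule[of _ ?T] by blast
    next
      case (ExL A \<Gamma> \<Delta>)
      let ?T = "\<lambda>z. add_mset (inst (subst (up \<sigma>) A) (Var z)) (image_mset (subst \<sigma>) \<Gamma>) \<^bold>\<Rightarrow>
        image_mset (subst \<sigma>) \<Delta>"
      have "?T z = subst_seq (\<sigma>(y := Var z)) (add_mset (inst A (Var y)) \<Gamma> \<^bold>\<Rightarrow> \<Delta>)" for z
        using fresh ExL
        by (simp add: subst_seq_def fv_seq_def subst_inst_fresh image_subst_fresh)
      then have "layered_derivable (?T z)" for z using IH ExL by simp
      moreover have "LJ_inference (StrongQuant z (\<^bold>\<exists> (subst (up \<sigma>) A))) [?T z] (subst_seq \<sigma> S)" for z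
        using ExL LJ_inference.ExL by (simp add: subst_seq_def)
      ultimately show ?thesis using layered_derivable_strong_rule[of _ ?T] by blast
    qed
  qed
qed

lemma LJ_layered_derivable:
  assumes "LJ S"
  shows "layered_derivable S"
proof -
  have "subst Var = (\<lambda>A::('a, 'b) fm. A)" by (rule ext) simp
  then have "subst_seq Var S = S" by (simp add: subst_seq_def)
  then show ?thesis
    using layered_derivable_subst[of S Var] assms by (simp add: LJ_iff_derivable)
qed

section \<open>Quantifier shifts without the eigenvariable condition\<close>

lemma layered_identity: "layered_derivable ({#A#} \<^bold>\<Rightarrow> {#A#})"
  using LJ_layered_derivable derivable_identity LJ_iff_derivable by blast

lemma layered_CD: "layered_derivable ({#} \<^bold>\<Rightarrow> {#\<^bold>\<forall> (A \<^bold>\<or> shift B) \<^bold>\<rightarrow> (\<^bold>\<forall> A) \<^bold>\<or> B#})"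
  unfolding layered_derivable_def
proof
  fix m
  let ?id = "\<lambda>F. {#F#} \<^bold>\<Rightarrow> {#F#}"
  have "\<exists>y E. layered m E \<and> (y, \<^bold>\<forall> A) \<in> E \<and>
      (\<forall>T \<in> set [?id (inst A (Var y)), ?id B]. derivable (strong_in E) T)"
    by (rule layered_derivable_strong) (simp add: layered_identity)
  then obtain y E where E: "layered m E" "(y, \<^bold>\<forall> A) \<in> E"
    "\<forall>T \<in> set [?id (inst A (Var y)), ?id B]. derivable (strong_in E) T"
    by blast
  \<comment> \<open>For the left disjunct, \<open>AllR\<close> generalises \<open>y\<close> on the
    right while \<open>inst A (Var y)\<close> is still the antecedent.\<close>
  have "derivable (strong_in E) ({#inst (A \<^bold>\<or> shift B) (Var y)#} \<^bold>\<Rightarrow> {#(\<^bold>\<forall> A) \<^bold>\<or> B#})"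
    using E(2,3) by (auto intro!: dDisjL intro: dDisjR1 dDisjR2 dAllR)
  then have "derivable (strong_in E) ({#} \<^bold>\<Rightarrow> {#\<^bold>\<forall> (A \<^bold>\<or> shift B) \<^bold>\<rightarrow> (\<^bold>\<forall> A) \<^bold>\<or> B#})"
    by (intro dImpR dAllL)
  with E(1) show "\<exists>E. layered m E \<and>
      derivable (strong_in E) ({#} \<^bold>\<Rightarrow> {#\<^bold>\<forall> (A \<^bold>\<or> shift B) \<^bold>\<rightarrow> (\<^bold>\<forall> A) \<^bold>\<or> B#})"
    by blast
qed

lemma layered_ED: "layered_derivable ({#} \<^bold>\<Rightarrow> {#(B \<^bold>\<rightarrow> \<^bold>\<exists> A) \<^bold>\<rightarrow> \<^bold>\<exists> (shift B \<^bold>\<rightarrow> A)#})"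
  unfolding layered_derivable_def
proof
  fix m
  let ?id = "\<lambda>F. {#F#} \<^bold>\<Rightarrow> {#F#}"
  have "\<exists>y E. layered m E \<and> (y, \<^bold>\<exists> A) \<in> E \<and>
      (\<forall>T \<in> set [?id (inst A (Var y)), ?id B]. derivable (strong_in E) T)"
    by (rule layered_derivable_strong) (simp add: layered_identity)
  then obtain y E where E: "layered m E" "(y, \<^bold>\<exists> A) \<in> E"
    "\<forall>T \<in> set [?id (inst A (Var y)), ?id B]. derivable (strong_in E) T"
    by blast
  \<comment> \<open>\<open>ExL\<close> is applied while its characteristic variable may still be
    free in the succedent.\<close>
  have "derivable (strong_in E) ({#\<^bold>\<exists> A#} \<^bold>\<Rightarrow> {#inst A (Var y)#})"
    using E(2,3) by (auto intro: dExL[where y = y])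
  from dWeakL[OF this, of B]
  have "derivable (strong_in E) (add_mset (\<^bold>\<exists> A) {#B#} \<^bold>\<Rightarrow> {#inst A (Var y)#})"
    by (simp add: add_mset_commute)
  then have "derivable (strong_in E) (add_mset (B \<^bold>\<rightarrow> \<^bold>\<exists> A) {#B#} \<^bold>\<Rightarrow> {#inst A (Var y)#})"
    using E(3) by (intro dImpL) auto
  then have "derivable (strong_in E) ({#B \<^bold>\<rightarrow> \<^bold>\<exists> A#} \<^bold>\<Rightarrow> {#inst (shift B \<^bold>\<rightarrow> A) (Var y)#})"
    by (auto intro!: dImpR simp: add_mset_commute)
  then have "derivable (strong_in E) ({#} \<^bold>\<Rightarrow> {#(B \<^bold>\<rightarrow> \<^bold>\<exists> A) \<^bold>\<rightarrow> \<^bold>\<exists> (shift B \<^bold>\<rightarrow> A)#})"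
    by (intro dImpR dExR)
  with E(1) show "\<exists>E. layered m E \<and>
      derivable (strong_in E) ({#} \<^bold>\<Rightarrow> {#(B \<^bold>\<rightarrow> \<^bold>\<exists> A) \<^bold>\<rightarrow> \<^bold>\<exists> (shift B \<^bold>\<rightarrow> A)#})"
    by blast
qed

lemma layered_SW: "layered_derivable ({#} \<^bold>\<Rightarrow> {#((\<^bold>\<forall> A) \<^bold>\<rightarrow> B) \<^bold>\<rightarrow> \<^bold>\<exists> (A \<^bold>\<rightarrow> shift B)#})"
  unfolding layered_derivable_def
proof
  fix m
  let ?id = "\<lambda>F. {#F#} \<^bold>\<Rightarrow> {#F#}"
  have "\<exists>y E. layered m E \<and> (y, \<^bold>\<forall> A) \<in> E \<and>
      (\<forall>T \<in> set [?id (inst A (Var y)), ?id B]. derivable (strong_in E) T)"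
    by (rule layered_derivable_strong) (simp add: layered_identity)
  then obtain y E where E: "layered m E" "(y, \<^bold>\<forall> A) \<in> E"
    "\<forall>T \<in> set [?id (inst A (Var y)), ?id B]. derivable (strong_in E) T"
    by blast
  have "derivable (strong_in E) ({#B#} \<^bold>\<Rightarrow> {#B#})" using E(3) by simp
  from dWeakL[OF this, of "inst A (Var y)"]
  have "derivable (strong_in E) (add_mset B {#inst A (Var y)#} \<^bold>\<Rightarrow> {#B#})"
    by (simp add: add_mset_commute)
  \<comment> \<open>The left premise of \<open>ImpL\<close> is again \<open>AllR\<close> with
    \<open>inst A (Var y)\<close> in the antecedent.\<close>
  then have "derivable (strong_in E) (add_mset ((\<^bold>\<forall> A) \<^bold>\<rightarrow> B) {#inst A (Var y)#} \<^bold>\<Rightarrow> {#B#})"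
    using E(2,3) by (intro dImpL) (auto intro: dAllR)
  then have "derivable (strong_in E) ({#(\<^bold>\<forall> A) \<^bold>\<rightarrow> B#} \<^bold>\<Rightarrow> {#inst (A \<^bold>\<rightarrow> shift B) (Var y)#})"
    by (auto intro!: dImpR simp: add_mset_commute)
  then have "derivable (strong_in E) ({#} \<^bold>\<Rightarrow> {#((\<^bold>\<forall> A) \<^bold>\<rightarrow> B) \<^bold>\<rightarrow> \<^bold>\<exists> (A \<^bold>\<rightarrow> shift B)#})"
    by (intro dImpR dExR)
  with E(1) show "\<exists>E. layered m E \<and>
      derivable (strong_in E) ({#} \<^bold>\<Rightarrow> {#((\<^bold>\<forall> A) \<^bold>\<rightarrow> B) \<^bold>\<rightarrow> \<^bold>\<exists> (A \<^bold>\<rightarrow> shift B)#})"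
    by blast
qed

lemma layered_QFS_instance:
  assumes "QFS_instance F"
  shows "layered_derivable ({#} \<^bold>\<Rightarrow> {#F#})"
proof -
  \<comment> \<open>For \<open>Gen\<close>, \<open>AllR\<close> needs the body instantiated at
    whatever variable the layering picks, so the claim must be closed under substitution.\<close>
  have "layered_derivable ({#} \<^bold>\<Rightarrow> {#subst \<sigma> F#})" for \<sigma>
    using assms
  proof (induction arbitrary: \<sigma>)
    case (Gen F)
    have "layered_derivable ({#} \<^bold>\<Rightarrow> {#inst (subst (up \<sigma>) F) (Var y)#})" for y
      unfolding inst_subst_up by (rule Gen.IH)
    then show ?case
      unfolding subst.simps by (rule layered_derivable_strong_rule[OF LJ_inference.AllR])
  qed (simp_all add: subst_up_shift layered_CD layered_ED layered_SW)
  from this[of Var] show ?thesis by simp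
qed

lemma layered_cut_instances:
  assumes "\<forall>F \<in># \<Delta>. QFS_instance F" "layered_derivable (\<Delta> + \<Gamma> \<^bold>\<Rightarrow> C)"
  shows "layered_derivable (\<Gamma> \<^bold>\<Rightarrow> C)"
  using assms
proof (induction \<Delta>)
  case (add F \<Delta>)
  have "layered_derivable ({#} + (\<Delta> + \<Gamma>) \<^bold>\<Rightarrow> C)"
    using add.prems layered_QFS_instance[of F]
    by (intro layered_derivable_rule[OF LJ_inference.Cut[of _ F]]) auto
  then show ?case using add by simp
qed simp

text \<open>Suitability is read off \<open>E\<close>: the bound \<open>m\<close> keeps
  characteristic variables out of the end-sequent, the layering places \<open>char_less\<close>
  inside \<open>>\<close>, and single-valuedness gives each variable one principal formula.\<close>

lemma layered_derivable_LJpp: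
  assumes "layered_derivable S"
  shows "LJpp S"
proof -
  obtain m where m: "\<forall>b \<in> fv_seq S. b < m" using ex_fresh finite_fv_seq by meson
  obtain E where E: "layered m E" "derivable (strong_in E) S"
    using assms by (auto simp: layered_derivable_def)
  then obtain \<pi> where \<pi>: "preproof \<pi>" "end_seq \<pi> = S"
    and strong: "\<And>y F T. (StrongQuant y F, T) \<in> inferences \<pi> \<Longrightarrow> (y, F) \<in> E"
    unfolding derivable_iff by blast
  have "char_less \<pi> \<subseteq> {(a, b). b < a}"
    using E(1) strong by (fastforce simp: char_less_def layered_def)
  moreover have "acyclic {(a, b :: nat). b < a}"
    by (rule acyclicI_order[where f = id]) auto
  ultimately have acyc: "acyclic (char_less \<pi>)" by (rule acyclic_subset[rotated])
  have "suitable \<pi> k" if "(k, T) \<in> inferences \<pi>" for k T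
  proof (cases k)
    case (StrongQuant y F)
    then have "m \<le> y" using strong that E(1) by (fastforce simp: layered_def)
    then have "y \<notin> fv_seq S" using m by fastforce
    moreover have "G = H" if "(StrongQuant b G, U) \<in> inferences \<pi>"
      "(StrongQuant b H, V) \<in> inferences \<pi>" for b G H U V
      using that[THEN strong] E(1) by (auto simp: layered_def single_valued_def)
    ultimately show ?thesis using StrongQuant acyc \<pi>(2) by auto
  qed auto
  then show ?thesis using \<pi> by (auto simp: LJpp_def LJpp_proof_def)
qed

lemma QFS_imp_LJpp:
  assumes "QFS S"
  shows "LJpp S"
proof -
  obtain \<Delta> where "\<forall>F \<in># \<Delta>. QFS_instance F" "LJ (\<Delta> + ante S \<^bold>\<Rightarrow> succe S)"
    using assms by (auto simp: QFS_def)
  then have "layered_derivable (ante S \<^bold>\<Rightarrow> succe S)"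
    using layered_cut_instances LJ_layered_derivable by blast
  then show ?thesis using layered_derivable_LJpp by simp
qed


subsection \<open>From \<open>LJ\<^sup>+\<^sup>+\<close> to \<open>LJ\<close> with quantifier shifts\<close>

text \<open>
  \<open>inst (critical F) (Var a)\<close> is the implication that licenses the strong-quantifier inference with
  principal formula \<open>F\<close> and characteristic variable \<open>a\<close>.  The default case is a junk value: principal
  formulas are quantified.
\<close>

definition critical :: "('f, 'p) fm \<Rightarrow> ('f, 'p) fm" where
  "critical F = (case F of \<^bold>\<forall> A \<Rightarrow> A \<^bold>\<rightarrow> shift F | \<^bold>\<exists> A \<Rightarrow> shift F \<^bold>\<rightarrow> A | _ \<Rightarrow> shift F \<^bold>\<rightarrow> shift F)"

lemma fv_critical: "fv (\<^bold>\<exists> (critical F)) \<subseteq> fv F"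
  by (auto simp: critical_def fv_shift split: fm.split)

lemma fv_inst_critical: "fv (inst (critical F) (Var a)) \<subseteq> insert a (fv F)"
  using fv_inst[of "critical F" "Var a"] fv_critical[of F] by auto

text \<open>Strong inferences become \<open>ImpL\<close> on implications in \<open>\<Theta>\<close>;
  every other inference is repeated with \<open>\<Theta>\<close> added to its context.\<close>

lemma derivable_critical:
  assumes "derivable (strong_in E) S" "\<And>a F. (a, F) \<in> E \<Longrightarrow> inst (critical F) (Var a) \<in># \<Theta>"
  shows "derivable eigen (\<Theta> + ante S \<^bold>\<Rightarrow> succe S)"
  using assms(1)
proof induction
  case (infer k Ss S)
  let ?D = "\<lambda>\<Gamma> \<Delta>. derivable eigen (\<Theta> + \<Gamma> \<^bold>\<Rightarrow> \<Delta>)"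
  \<comment> \<open>The principal implication of \<open>ImpL\<close> is an extra copy, contracted
    into the one already in \<open>\<Theta>\<close>.\<close>
  have licence: "derivable eigen (\<Theta> + \<Gamma> \<^bold>\<Rightarrow> \<Delta>)"
    if "A \<^bold>\<rightarrow> B \<in># \<Theta>" "?D \<Gamma> {#A#}" "?D (add_mset B \<Gamma>) \<Delta>" for A B \<Gamma> \<Delta>
  proof -
    have "derivable eigen (add_mset (A \<^bold>\<rightarrow> B) (\<Theta> + \<Gamma>) \<^bold>\<Rightarrow> \<Delta>)"
      using that by (intro dImpL) auto
    then show ?thesis using that(1) dContrL[of _ "A \<^bold>\<rightarrow> B" "\<Theta> - {#A \<^bold>\<rightarrow> B#} + \<Gamma>" \<Delta>]
      by (simp add: insert_DiffM2 flip: union_mset_add_mset_left)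
  qed
  have id: "?D (add_mset A \<Gamma>) {#A#}" for A \<Gamma>
    using derivable_weaken[OF derivable_identity, of "\<Theta> + \<Gamma>" A] by simp
  have IH: "\<forall>T \<in> set Ss. ?D (ante T) (succe T)" using infer.IH by blast
  from infer.hyps(1) show ?case
  proof (cases rule: LJ_inference.cases)
    case (AllR y A \<Gamma>)
    have "(A' \<^bold>\<rightarrow> \<^bold>\<forall> A) \<in># \<Theta>" if "A' = inst A (Var y)" for A'
      using assms(2)[OF infer.hyps(3)[OF AllR(1)]] that by (simp add: critical_def)
    then show ?thesis using licence id IH AllR by auto
  next
    case (ExL y A \<Gamma> \<Delta>)
    have imp: "\<^bold>\<exists> A \<^bold>\<rightarrow> inst A (Var y) \<in># \<Theta>"
      using assms(2)[OF infer.hyps(3)[OF ExL(1)]] by (simp add: critical_def)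
    have "?D (add_mset (inst A (Var y)) (add_mset (\<^bold>\<exists> A) \<Gamma>)) \<Delta>"
      using IH ExL dWeakL[of _ "\<Theta> + add_mset (inst A (Var y)) \<Gamma>" \<Delta> "\<^bold>\<exists> A"]
      by (simp add: add_mset_commute)
    then show ?thesis using licence[OF imp id] ExL by simp
  next
    case (Cut \<Gamma> A \<Pi> \<Delta>)
    have "?D \<Gamma> {#A#}" "derivable eigen (add_mset A (\<Theta> + \<Pi>) \<^bold>\<Rightarrow> \<Delta>)"
      using IH Cut by simp_all
    then have "derivable eigen ((\<Theta> + \<Gamma>) + (\<Theta> + \<Pi>) \<^bold>\<Rightarrow> \<Delta>)"
      by (rule dCut)
    then show ?thesis using Cut derivable_contract[of _ \<Theta> "\<Gamma> + \<Pi>"] by (simp add: ac_simps)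
  next
    case (Ax p ts)
    then show ?thesis using id[of _ "{#}"] by simp
  next
    case FalsumL
    then show ?thesis
      using derivable_weaken[OF derivable_rule[OF LJ_inference.FalsumL]] by simp
  next
    case (WeakL \<Gamma> \<Delta> A)
    then show ?thesis using IH by (auto intro: dWeakL)
  next
    case (WeakR \<Gamma> A)
    then show ?thesis using IH by (auto intro: dWeakR)
  next
    case (ContrL A \<Gamma> \<Delta>)
    then show ?thesis using IH by (auto intro: dContrL)
  next
    case (ConjL1 A \<Gamma> \<Delta> B)
    then show ?thesis using IH by (auto intro: dConjL1)
  next
    case (ConjL2 B \<Gamma> \<Delta> A)
    then show ?thesis using IH by (auto intro: dConjL2)
  next
    case (ConjR \<Gamma> A B)
    then show ?thesis using IH by (auto intro: dConjR)
  next
    case (DisjR1 \<Gamma> A B)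
    then show ?thesis using IH by (auto intro: dDisjR1)
  next
    case (DisjR2 \<Gamma> B A)
    then show ?thesis using IH by (auto intro: dDisjR2)
  next
    case (DisjL A \<Gamma> \<Delta> B)
    then show ?thesis using IH by (auto intro: dDisjL)
  next
    case (ImpL \<Gamma> A B \<Delta>)
    then show ?thesis using IH by (auto intro: dImpL)
  next
    case (ImpR A \<Gamma> B)
    then show ?thesis using IH by (auto intro: dImpR)
  next
    case (AllL A t \<Gamma> \<Delta>)
    then show ?thesis using IH by (auto intro: dAllL)
  next
    case (ExR \<Gamma> A t)
    then show ?thesis using IH by (auto intro: dExR)
  qed
qed

section \<open>Critical formulas from closed instances of the schemata\<close>

lemma derivable_closure_instance:
  assumes "fv ((All ^^ n) F) = {}"
  shows "derivable eigen ({#(All ^^ n) F#} \<^bold>\<Rightarrow> {#subst \<sigma> F#})"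
  using assms
proof (induction n arbitrary: F \<sigma>)
  case 0
  then have "subst \<sigma> F = subst Var F" by (intro subst_cong) simp
  then show ?case by (simp add: derivable_identity)
next
  case (Suc n)
  have "(All ^^ Suc n) F = (All ^^ n) (\<^bold>\<forall> F)" by (simp add: funpow_swap1)
  \<comment> \<open>The innermost quantifier binds index 0: the outer ones are instantiated by the
    tail of \<open>\<sigma>\<close>, and \<open>\<sigma> 0\<close> is supplied by a last
    \<open>AllL\<close>.\<close>
  then have "derivable eigen ({#(All ^^ Suc n) F#} \<^bold>\<Rightarrow> {#\<^bold>\<forall> (subst (up (\<lambda>n. \<sigma> (Suc n))) F)#})"
    using Suc.IH[of "\<^bold>\<forall> F" "\<lambda>n. \<sigma> (Suc n)"] Suc.prems by simp
  moreover have "case_nat (\<sigma> 0) (\<lambda>n. \<sigma> (Suc n)) = \<sigma>"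
    by (rule ext) (simp split: nat.split)
  then have "derivable eigen (add_mset (\<^bold>\<forall> (subst (up (\<lambda>n. \<sigma> (Suc n))) F)) {#} \<^bold>\<Rightarrow> {#subst \<sigma> F#})"
    using derivable_identity[of "subst \<sigma> F"]
    by (intro dAllL[where t = "\<sigma> 0"]) (simp add: inst_subst_up)
  ultimately show ?case using dCut[of eigen _ _ "{#}"] by simp
qed

definition closed_instances :: "('f, 'p) fm multiset \<Rightarrow> bool" where
  "closed_instances \<Delta> \<longleftrightarrow> (\<forall>F \<in># \<Delta>. QFS_instance F \<and> fv F = {})"

lemma fv_funpow_All: "fv ((All ^^ n) F) = {k. k + n \<in> fv F}"
  by (induction n arbitrary: F) auto

lemma derivable_QFS_instance:
  assumes "QFS_instance F"
  shows "\<exists>\<Delta>. closed_instances \<Delta> \<and> derivable eigen (\<Delta> \<^bold>\<Rightarrow> {#F#})"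
proof -
  obtain n where "\<forall>b \<in> fv F. b < n" using ex_fresh finite_fv by meson
  then have closed: "fv ((All ^^ n) F) = {}" by (fastforce simp: fv_funpow_All)
  have "QFS_instance ((All ^^ n) F)" using assms by (induction n) (auto intro: Gen)
  then show ?thesis
    using closed derivable_closure_instance[OF closed, of Var]
    by (intro exI[of _ "{#(All ^^ n) F#}"]) (simp add: closed_instances_def)
qed

lemma derivable_Ex_critical:
  "\<exists>\<Delta>. closed_instances \<Delta> \<and> derivable eigen (\<Delta> \<^bold>\<Rightarrow> {#\<^bold>\<exists> (critical F)#})"
proof -
  have triv: "derivable eigen ({#} \<^bold>\<Rightarrow> {#G \<^bold>\<rightarrow> G#})" for G :: "('a, 'b) fm"
    by (intro dImpR derivable_identity)
  have shift: ?thesis if "QFS_instance ((G \<^bold>\<rightarrow> G) \<^bold>\<rightarrow> \<^bold>\<exists> (critical F))" for G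
  proof -
    obtain \<Delta> where \<Delta>: "closed_instances \<Delta>"
      "derivable eigen (\<Delta> \<^bold>\<Rightarrow> {#(G \<^bold>\<rightarrow> G) \<^bold>\<rightarrow> \<^bold>\<exists> (critical F)#})"
      using derivable_QFS_instance \<open>QFS_instance _\<close> by blast
    have "derivable eigen (add_mset ((G \<^bold>\<rightarrow> G) \<^bold>\<rightarrow> \<^bold>\<exists> (critical F)) {#} \<^bold>\<Rightarrow> {#\<^bold>\<exists> (critical F)#})"
      by (intro dImpL triv derivable_identity)
    then show ?thesis using \<Delta>(1) dCut[OF \<Delta>(2), of "{#}"] by auto
  qed
  consider A where "F = \<^bold>\<forall> A" | A where "F = \<^bold>\<exists> A" | "critical F = shift (F \<^bold>\<rightarrow> F)"
    by (cases F) (auto simp: critical_def shift_def)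
  then show ?thesis
  proof cases
    case 1
    then show ?thesis by (intro shift[of F]) (simp add: critical_def QFS_instance.SW)
  next
    case 2
    then show ?thesis by (intro shift[of F]) (simp add: critical_def QFS_instance.ED)
  next
    case 3
    then have "derivable eigen ({#} \<^bold>\<Rightarrow> {#\<^bold>\<exists> (critical F)#})"
      using triv by (auto intro!: dExR)
    then show ?thesis by (intro exI[of _ "{#}"]) (simp add: closed_instances_def)
  qed
qed

text \<open>
  A \<open><\<^sub>\<pi>\<close>-minimal characteristic variable \<open>a\<close> is free in no critical formula but its own, which can
  therefore be existentially quantified by a regular \<open>(\<exists>L)\<close> and then cut against a quantifier shift.
\<close>

lemma eliminate_critical:
  assumes "finite E" "single_valued E" "acyclic {(a, b). \<exists>F. (a, F) \<in> E \<and> b \<in> fv F}"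
    and "\<forall>a \<in> Domain E. a \<notin> fv_seq (\<Gamma> \<^bold>\<Rightarrow> C)"
    and "closed_instances \<Delta>"
    and "derivable eigen (image_mset (\<lambda>(a, F). inst (critical F) (Var a)) (mset_set E) + (\<Delta> + \<Gamma>) \<^bold>\<Rightarrow> C)"
  shows "\<exists>\<Delta>. closed_instances \<Delta> \<and> derivable eigen (\<Delta> + \<Gamma> \<^bold>\<Rightarrow> C)"
  using assms
proof (induction "card E" arbitrary: E \<Delta>)
  case 0
  then show ?case by auto
next
  case (Suc n)
  let ?R = "\<lambda>E. {(a, b). \<exists>F. (a, F) \<in> E \<and> b \<in> fv F}"
  let ?\<Theta> = "\<lambda>E. image_mset (\<lambda>(a, F). inst (critical F) (Var a)) (mset_set E)"
  have "?R E = (\<Union>(a, F) \<in> E. {a} \<times> fv F)" by auto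
  then have "finite (?R E)" using Suc.prems(1) by auto
  then have "wf (?R E)" using Suc.prems(3) finite_acyclic_wf by blast
  moreover have "E \<noteq> {}" using Suc.hyps(2) by auto
  \<comment> \<open>A finite acyclic relation is well-founded, so some characteristic variable
    \<open>a\<close> is free in no principal formula of \<open>E\<close>, its own included.\<close>
  ultimately obtain a where a: "a \<in> Domain E" "\<And>b. (b, a) \<in> ?R E \<Longrightarrow> b \<notin> Domain E"
    by (metis (no_types, lifting) Domain_empty_iff equals0I wfE_min)
  then obtain F where F: "(a, F) \<in> E" by blast
  define E' where "E' = E - {(a, F)}"
  have E: "E = insert (a, F) E'" "(a, F) \<notin> E'" "finite E'" "card E' = n"
    using F Suc.prems(1) Suc.hyps(2) by (auto simp: E'_def)
  have min: "a \<notin> fv G" if "(b, G) \<in> E" for b G using a(2) that by blast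
  \<comment> \<open>By single-valuedness the critical formula removed now is the only one belonging
    to \<open>a\<close>.\<close>
  have neq: "b \<noteq> a" if "(b, G) \<in> E'" for b G
    using that F Suc.prems(2) by (auto simp: E'_def single_valued_def)
  obtain \<Delta>' where \<Delta>': "closed_instances \<Delta>'" "derivable eigen (\<Delta>' \<^bold>\<Rightarrow> {#\<^bold>\<exists> (critical F)#})"
    using derivable_Ex_critical by blast
  have "\<forall>G \<in># ?\<Theta> E'. a \<notin> fv G"
  proof
    fix G assume "G \<in># ?\<Theta> E'"
    then obtain b H where "(b, H) \<in> E'" "G = inst (critical H) (Var b)" using E(3) by auto
    then show "a \<notin> fv G" using fv_inst_critical[of H b] neq min E(1) by blast
  qed
  moreover have "\<forall>G \<in># \<Delta>. a \<notin> fv G" using Suc.prems(5) by (simp add: closed_instances_def)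
  moreover have "a \<notin> fv (\<^bold>\<exists> (critical F))" using fv_critical min F by blast
  ultimately have "a \<notin> fv_seq (add_mset (\<^bold>\<exists> (critical F)) (?\<Theta> E' + (\<Delta> + \<Gamma>)) \<^bold>\<Rightarrow> C)"
    using Suc.prems(4) a(1) unfolding fv_seq_def by auto
  moreover have "derivable eigen (add_mset (inst (critical F) (Var a)) (?\<Theta> E' + (\<Delta> + \<Gamma>)) \<^bold>\<Rightarrow> C)"
    using Suc.prems(6) E by simp
  ultimately have "derivable eigen (add_mset (\<^bold>\<exists> (critical F)) (?\<Theta> E' + (\<Delta> + \<Gamma>)) \<^bold>\<Rightarrow> C)"
    by (intro dExL)
  then have "derivable eigen (?\<Theta> E' + ((\<Delta>' + \<Delta>) + \<Gamma>) \<^bold>\<Rightarrow> C)"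
    using dCut[OF \<Delta>'(2), of "?\<Theta> E' + (\<Delta> + \<Gamma>)" C] by (simp add: ac_simps)
  moreover have "closed_instances (\<Delta>' + \<Delta>)"
    using \<Delta>'(1) Suc.prems(5) by (auto simp: closed_instances_def)
  moreover have "acyclic (?R E')"
    using Suc.prems(3) by (rule acyclic_subset) (auto simp: E'_def)
  moreover have "single_valued E'"
    using Suc.prems(2) by (auto simp: E'_def single_valued_def)
  moreover have "\<forall>a \<in> Domain E'. a \<notin> fv_seq (\<Gamma> \<^bold>\<Rightarrow> C)"
    using Suc.prems(4) by (auto simp: E'_def)
  ultimately show ?case using Suc.hyps(1)[of E' "\<Delta>' + \<Delta>"] E(3,4) by blast
qed

lemma finite_inferences: "finite (inferences \<pi>)"
  by (induction \<pi>) auto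

lemma LJpp_imp_QFS:
  assumes "LJpp S"
  shows "QFS S"
proof -
  obtain \<pi> where \<pi>: "preproof \<pi>" "end_seq \<pi> = S"
    and suit: "\<And>k T. (k, T) \<in> inferences \<pi> \<Longrightarrow> suitable \<pi> k"
    using assms by (auto simp: LJpp_def LJpp_proof_def)
  define E where "E = {(a, F). \<exists>T. (StrongQuant a F, T) \<in> inferences \<pi>}"
  have "E \<subseteq> (\<lambda>(k, T). case k of StrongQuant a F \<Rightarrow> (a, F)) ` inferences \<pi>"
    by (force simp: E_def)
  then have fin: "finite E" using finite_inferences finite_surj by blast
  have R: "{(a, b). \<exists>F. (a, F) \<in> E \<and> b \<in> fv F} = char_less \<pi>"
    by (auto simp: E_def char_less_def)
  have sv: "single_valued E"
    unfolding single_valued_def E_def using suit by fastforce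
  \<comment> \<open>Acyclicity is asserted by \<open>suitable\<close> at strong inferences; if there
    are none, \<open>char_less \<pi>\<close> is empty.\<close>
  have acyc: "acyclic (char_less \<pi>)"
  proof (cases "E = {}")
    case True
    then show ?thesis using R by (auto simp: acyclic_def)
  next
    case False
    then show ?thesis using suit by (fastforce simp: E_def)
  qed
  have fresh: "\<forall>a \<in> Domain E. a \<notin> fv_seq (ante S \<^bold>\<Rightarrow> succe S)"
    using suit \<pi>(2) by (fastforce simp: E_def)
  have "derivable (strong_in E) S"
    using \<pi> unfolding derivable_iff by (auto simp: E_def)
  moreover have "inst (critical F) (Var a) \<in>#
      image_mset (\<lambda>(a, F). inst (critical F) (Var a)) (mset_set E)" if "(a, F) \<in> E" for a F
    using that fin by force
  ultimately have "derivable eigen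
      (image_mset (\<lambda>(a, F). inst (critical F) (Var a)) (mset_set E) + ({#} + ante S) \<^bold>\<Rightarrow> succe S)"
    unfolding add_0 by (rule derivable_critical)
  then obtain \<Delta> where "closed_instances \<Delta>" "derivable eigen (\<Delta> + ante S \<^bold>\<Rightarrow> succe S)"
    using eliminate_critical[OF fin sv _ fresh, of "{#}"] R acyc
    by (auto simp: closed_instances_def)
  then show ?thesis
    by (auto simp: QFS_def LJ_iff_derivable closed_instances_def)
qed

theorem mainTheorem6:
  fixes S :: "('f, 'p) sequent"
  shows "LJpp S \<longleftrightarrow> QFS S"
  using LJpp_imp_QFS QFS_imp_LJpp by blast

end
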